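(* The group $S=(\hat{\mathbb Z}\times\mathbb R)/\mathbb Z$ is compact and connected and is canonically isomorphic to the projective limit of the compact groups $\mathbb R/n\mathbb Z$, under divisibility of the labels $n$.
   Context: $\hat{\mathbb Z}=\varprojlim\mathbb Z/n\mathbb Z$, and $\mathbb Z$ is embedded diagonally in $\hat{\mathbb Z}\times\mathbb R$ (generated by $(1,1)$). In the projective limit, for $n|m$ the transition map is the canonical projection $\mathbb R/m\mathbb Z\to\mathbb R/n\mathbb Z$. *)

theory Defs
  imports "HOL-Analysis.Analysis" "HOL-Algebra.Algebra"
begin

section \<open>Topological groups\<close>

definition topological_group :: "('a, 'b) monoid_scheme \<Rightarrow> 'a topology \<Rightarrow> bool" where
  "topological_group G T \<longleftrightarrow>
     group G \<and> topspace T = carrier G \<and>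
     continuous_map (prod_topology T T) T (\<lambda>(x, y). x \<otimes>\<^bsub>G\<^esub> y) \<and>
     continuous_map T T (\<lambda>x. inv\<^bsub>G\<^esub> x)"

text \<open>As usual for topological groups, compact includes Hausdorff.\<close>

definition compact_group :: "('a, 'b) monoid_scheme \<Rightarrow> 'a topology \<Rightarrow> bool" where
  "compact_group G T \<longleftrightarrow> topological_group G T \<and> compact_space T \<and> Hausdorff_space T"

definition topological_iso ::
  "('a, 'c) monoid_scheme \<Rightarrow> 'a topology \<Rightarrow> ('b, 'd) monoid_scheme \<Rightarrow> 'b topology \<Rightarrow> ('a \<Rightarrow> 'b) set"
where
  "topological_iso G T H U = {f \<in> iso G H. homeomorphic_map T U f}"


section \<open>Quotients\<close>

definition quotient_topology :: "'a topology \<Rightarrow> ('a \<Rightarrow> 'b) \<Rightarrow> 'b topology" where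
  "quotient_topology T f =
     topology (\<lambda>U. U \<subseteq> f ` topspace T \<and> openin T {x \<in> topspace T. f x \<in> U})"

lemma openin_quotient_topology:
  "openin (quotient_topology T f) U \<longleftrightarrow>
     U \<subseteq> f ` topspace T \<and> openin T {x \<in> topspace T. f x \<in> U}"
proof -
  let ?P = "\<lambda>U. U \<subseteq> f ` topspace T \<and> openin T {x \<in> topspace T. f x \<in> U}"
  have "istopology ?P"
    unfolding istopology_def
  proof (intro conjI allI impI)
    fix A B assume A: "?P A" and B: "?P B"
    show "A \<inter> B \<subseteq> f ` topspace T" using A by blast
    have "{x \<in> topspace T. f x \<in> A \<inter> B} =
        {x \<in> topspace T. f x \<in> A} \<inter> {x \<in> topspace T. f x \<in> B}" by blast
    then show "openin T {x \<in> topspace T. f x \<in> A \<inter> B}" using A B by (simp only: openin_Int)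
  next
    fix K assume K: "\<forall>A\<in>K. ?P A"
    then show "\<Union>K \<subseteq> f ` topspace T" by blast
    have "{x \<in> topspace T. f x \<in> \<Union>K} = (\<Union>A\<in>K. {x \<in> topspace T. f x \<in> A})" by blast
    moreover have "openin T (\<Union>A\<in>K. {x \<in> topspace T. f x \<in> A})" 
    proof (rule openin_Union)
      fix S assume "S \<in> (\<lambda>A. {x \<in> topspace T. f x \<in> A}) ` K"
      then obtain A where "A \<in> K" and S: "S = {x \<in> topspace T. f x \<in> A}" by (rule imageE)
      show "openin T S" unfolding S by (rule conjunct2[OF K[rule_format, OF \<open>A \<in> K\<close>]])
    qed
    ultimately show "openin T {x \<in> topspace T. f x \<in> \<Union>K}" by (simp only:)
  qed
  then show ?thesis
    unfolding quotient_topology_def by (simp add: topology_inverse')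
qed

lemma topspace_quotient_topology [simp]:
  "topspace (quotient_topology T f) = f ` topspace T"
proof (rule antisym)
  show "topspace (quotient_topology T f) \<subseteq> f ` topspace T"
    using openin_topspace[of "quotient_topology T f", unfolded openin_quotient_topology]
    by (rule conjunct1)
  have "{x \<in> topspace T. f x \<in> f ` topspace T} = topspace T" by blast
  then have "openin (quotient_topology T f) (f ` topspace T)"
    by (simp add: openin_quotient_topology)
  then show "f ` topspace T \<subseteq> topspace (quotient_topology T f)"
    by (rule openin_subset)
qed

lemma quotient_map_quotient_topology: "quotient_map T (quotient_topology T f) f"
  unfolding quotient_map_def topspace_quotient_topology
proof (intro conjI allI impI refl)
  fix U assume "U \<subseteq> f ` topspace T"
  then show "openin T {x \<in> topspace T. f x \<in> U} = openin (quotient_topology T f) U"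
    by (simp only: openin_quotient_topology simp_thms)
qed

definition coset_topology :: "('a, 'b) monoid_scheme \<Rightarrow> 'a set \<Rightarrow> 'a topology \<Rightarrow> 'a set topology" where
  "coset_topology G H T = quotient_topology T (\<lambda>x. H #>\<^bsub>G\<^esub> x)"

text \<open>For \<open>H \<subseteq> K\<close>, the canonical projection \<open>G Mod H \<rightarrow> G Mod K\<close> that sends \<open>H #> x\<close> to
  \<open>K #> x\<close>; multiplying a coset of \<open>H\<close> by \<open>K\<close> avoids the choice of a representative.\<close>

definition coset_projection :: "('a, 'b) monoid_scheme \<Rightarrow> 'a set \<Rightarrow> 'a set \<Rightarrow> 'a set" where
  "coset_projection G K C = K <#>\<^bsub>G\<^esub> C"

lemma coset_projection_coset:
  assumes "group G" and "subgroup H G" and "subgroup K G" and "H \<subseteq> K" and "x \<in> carrier G"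
  shows "coset_projection G K (H #>\<^bsub>G\<^esub> x) = K #>\<^bsub>G\<^esub> x"
proof -
  interpret group G by fact
  have HK: "H \<subseteq> carrier G" "K \<subseteq> carrier G"
    using assms subgroup.subset by blast+
  have "K <#>\<^bsub>G\<^esub> H = K"
  proof
    show "K <#>\<^bsub>G\<^esub> H \<subseteq> K"
      using assms(4) subgroup.m_closed[OF assms(3)] unfolding set_mult_def by blast
    show "K \<subseteq> K <#>\<^bsub>G\<^esub> H"
    proof
      fix k assume "k \<in> K"
      moreover have "\<one>\<^bsub>G\<^esub> \<in> H" using assms(2) by (rule subgroup.one_closed)
      moreover have "k = k \<otimes>\<^bsub>G\<^esub> \<one>\<^bsub>G\<^esub>" using \<open>k \<in> K\<close> HK by auto
      ultimately show "k \<in> K <#>\<^bsub>G\<^esub> H" unfolding set_mult_def by blast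
    qed
  qed
  then show ?thesis
    using setmult_rcos_assoc[OF HK(2,1) assms(5)] by (simp add: coset_projection_def)
qed


section \<open>Projective limits under divisibility\<close>

text \<open>The labels are the integers \<open>n > 0\<close>. For \<open>n dvd m\<close>, the transition map from \<open>G m\<close> to
  \<open>G n\<close> is \<open>p n\<close>: canonical projections between quotients of a fixed group depend only on
  the label of their target (see \<open>coset_projection\<close>).\<close>

definition divlim_carrier :: "(nat \<Rightarrow> 'a monoid) \<Rightarrow> (nat \<Rightarrow> 'a \<Rightarrow> 'a) \<Rightarrow> (nat \<Rightarrow> 'a) set" where
  "divlim_carrier G p =
     {x \<in> (\<Pi>\<^sub>E n\<in>{0<..}. carrier (G n)). \<forall>n>0. \<forall>m>0. n dvd m \<longrightarrow> p n (x m) = x n}"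

definition divlim_group :: "(nat \<Rightarrow> 'a monoid) \<Rightarrow> (nat \<Rightarrow> 'a \<Rightarrow> 'a) \<Rightarrow> (nat \<Rightarrow> 'a) monoid" where
  "divlim_group G p = (product_group {0<..} G)\<lparr>carrier := divlim_carrier G p\<rparr>"

definition divlim_topology ::
  "(nat \<Rightarrow> 'a monoid) \<Rightarrow> (nat \<Rightarrow> 'a topology) \<Rightarrow> (nat \<Rightarrow> 'a \<Rightarrow> 'a) \<Rightarrow> (nat \<Rightarrow> 'a) topology" where
  "divlim_topology G T p = subtopology (product_topology T {0<..}) (divlim_carrier G p)"


section \<open>The profinite integers\<close>

definition int_multiples :: "nat \<Rightarrow> int set" where
  "int_multiples n = range (\<lambda>k. int n * k)"

definition int_mod_group :: "nat \<Rightarrow> int set monoid" where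
  "int_mod_group n = integer_group Mod int_multiples n"

definition int_mod_topology :: "nat \<Rightarrow> int set topology" where
  "int_mod_topology n = discrete_topology (carrier (int_mod_group n))"

definition int_mod_proj :: "nat \<Rightarrow> int set \<Rightarrow> int set" where
  "int_mod_proj n = coset_projection integer_group (int_multiples n)"

definition Zhat :: "(nat \<Rightarrow> int set) monoid" where
  "Zhat = divlim_group int_mod_group int_mod_proj"

definition Zhat_topology :: "(nat \<Rightarrow> int set) topology" where
  "Zhat_topology = divlim_topology int_mod_group int_mod_topology int_mod_proj"

definition int_to_Zhat :: "int \<Rightarrow> nat \<Rightarrow> int set" where
  "int_to_Zhat k = (\<lambda>n\<in>{0<..}. int_multiples n #>\<^bsub>integer_group\<^esub> k)"


section \<open>The circles \<open>\<real>/n\<int>\<close> and their projective limit\<close>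

definition real_group :: "real monoid" where
  "real_group = \<lparr>carrier = UNIV, monoid.mult = (+), one = 0\<rparr>"

definition real_multiples :: "nat \<Rightarrow> real set" where
  "real_multiples n = range (\<lambda>k::int. real n * of_int k)"

definition circle_group :: "nat \<Rightarrow> real set monoid" where
  "circle_group n = real_group Mod real_multiples n"

definition circle_topology :: "nat \<Rightarrow> real set topology" where
  "circle_topology n = coset_topology real_group (real_multiples n) euclideanreal"

definition circle_proj :: "nat \<Rightarrow> real set \<Rightarrow> real set" where
  "circle_proj n = coset_projection real_group (real_multiples n)"

definition circle_limit :: "(nat \<Rightarrow> real set) monoid" where
  "circle_limit = divlim_group circle_group circle_proj"

definition circle_limit_topology :: "(nat \<Rightarrow> real set) topology" where
  "circle_limit_topology = divlim_topology circle_group circle_topology circle_proj"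


section \<open>The group \<open>S\<close>\<close>

definition diagonal_int :: "((nat \<Rightarrow> int set) \<times> real) set" where
  "diagonal_int = range (\<lambda>k. (int_to_Zhat k, of_int k))"

definition S_group :: "((nat \<Rightarrow> int set) \<times> real) set monoid" where
  "S_group = (Zhat \<times>\<times> real_group) Mod diagonal_int"

definition S_topology :: "((nat \<Rightarrow> int set) \<times> real) set topology" where
  "S_topology =
     coset_topology (Zhat \<times>\<times> real_group) diagonal_int (prod_topology Zhat_topology euclideanreal)"

definition S_class :: "(nat \<Rightarrow> int set) \<Rightarrow> real \<Rightarrow> ((nat \<Rightarrow> int set) \<times> real) set" where
  "S_class a x = diagonal_int #>\<^bsub>Zhat \<times>\<times> real_group\<^esub> (a, x)"

text \<open>The canonical map \<open>S \<rightarrow> \<real>/n\<int>\<close> factors as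
  \<open>(Zhat \<times> \<real>)/\<int> \<rightarrow> (\<int>/n\<int> \<times> \<real>)/\<int> \<cong> \<real>/n\<int>\<close>, where the isomorphism is inverse to the one
  induced by \<open>x \<mapsto> (0, x)\<close>. As \<open>(k, x)\<close> and \<open>(0, x - k)\<close> differ by the diagonal element \<open>k\<close>, the
  class of \<open>(a, x)\<close> is sent to the class of \<open>x - k\<close>, where \<open>k\<close> is any integer representing the
  component \<open>a n\<close> (a coset, i.e. a set of integers). Since the classes of \<open>S\<close> are exhausted by
  the \<open>S_class a x\<close>, this determines a map to the limit completely on the carrier of \<open>S\<close>.\<close>

definition canonical_on_S ::
  "(((nat \<Rightarrow> int set) \<times> real) set \<Rightarrow> nat \<Rightarrow> real set) \<Rightarrow> bool" where
  "canonical_on_S \<phi> \<longleftrightarrow>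
     (\<forall>a\<in>carrier Zhat. \<forall>x. \<forall>n>0. \<forall>k\<in>a n.
        \<phi> (S_class a x) n = real_multiples n #>\<^bsub>real_group\<^esub> (x - of_int k))"

end

theory Submission
  imports Defs
begin

text \<open>The homomorphism from \<open>Zhat \<times> \<real>\<close> to the limit of the circles that sends \<open>(a, x)\<close> to the family
  of classes of \<open>x - a n\<close> is continuous. It is onto: if \<open>y n\<close> represents the component at \<open>n\<close> of a
  point of the limit, the differences \<open>y 1 - y n\<close> are integers and form an element of \<open>Zhat\<close>. An
  element \<open>(a, x)\<close> is in the kernel iff \<open>x\<close> is an integer (look at \<open>n = 1\<close>) that represents every
  component of \<open>a\<close>, so the kernel is the diagonal copy of \<open>\<int>\<close>. The induced bijection from \<open>S\<close> to the
  limit is a homeomorphism because \<open>S\<close>, the image of \<open>Zhat \<times> [0, 1]\<close>, is compact and the limit is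
  Hausdorff. The limit is connected because the image of \<open>\<real>\<close> is dense in it.\<close>

section \<open>Quotients of topological groups\<close>

lemma topological_groupD:
  assumes "topological_group G T"
  shows "group G" and "topspace T = carrier G"
    and "continuous_map (prod_topology T T) T (\<lambda>(x, y). x \<otimes>\<^bsub>G\<^esub> y)"
    and "continuous_map T T (\<lambda>x. inv\<^bsub>G\<^esub> x)"
  using assms by (auto simp: topological_group_def)

lemma topological_group_continuous_mult:
  assumes "topological_group G T" and "continuous_map Z T f" and "continuous_map Z T g"
  shows "continuous_map Z T (\<lambda>x. f x \<otimes>\<^bsub>G\<^esub> g x)"
  using continuous_map_compose[OF continuous_map_pairedI[OF assms(2,3)] topological_groupD(3)[OF assms(1)]]
  by (simp add: o_def)

lemma topological_group_continuous_inv: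
  assumes "topological_group G T" and "continuous_map Z T f"
  shows "continuous_map Z T (\<lambda>x. inv\<^bsub>G\<^esub> f x)"
  using continuous_map_compose[OF assms(2) topological_groupD(4)[OF assms(1)]]
  by (simp add: o_def)

lemma topspace_coset_topology [simp]:
  "topspace (coset_topology G N T) = (\<lambda>x. N #>\<^bsub>G\<^esub> x) ` topspace T"
  by (simp add: coset_topology_def)

lemma quotient_map_coset_topology:
  "quotient_map T (coset_topology G N T) (\<lambda>x. N #>\<^bsub>G\<^esub> x)"
  unfolding coset_topology_def by (rule quotient_map_quotient_topology)

lemma continuous_map_coset:
  assumes "continuous_map Z T f"
  shows "continuous_map Z (coset_topology G N T) (\<lambda>x. N #>\<^bsub>G\<^esub> f x)"
  using continuous_map_compose[OF assms quotient_imp_continuous_map[OF quotient_map_coset_topology]]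
  by (simp add: o_def)

text \<open>Turns an equality of cosets into a membership in \<open>N\<close>. Every later
  comparison of classes, in the circles, in Z/nZ and in S, goes through this form.\<close>

lemma (in group) rcos_eq_iff:
  assumes "subgroup N G" and "x \<in> carrier G" and "y \<in> carrier G"
  shows "N #> x = N #> y \<longleftrightarrow> y \<otimes> inv x \<in> N"
proof -
  have "N #> x = N #> y \<longleftrightarrow> y \<in> N #> x"
    using repr_independence[OF _ assms(2,1)] repr_independenceD[OF assms(1,3)] by blast
  also have "\<dots> \<longleftrightarrow> y \<otimes> inv x \<in> N"
    using subgroup.rcos_module[OF assms(1) is_group assms(2,3)] .
  finally show ?thesis .
qed

text \<open>The saturation of \<open>U\<close> is the union over \<open>h\<close> in
  \<open>N\<close> of the preimages of \<open>U\<close> under left multiplication by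
  \<open>h\<close>, and each of these is open. So the projection to the cosets is an open
  map.\<close>

lemma openin_coset_image:
  fixes G (structure)
  assumes TG: "topological_group G T" and N: "subgroup N G" and U: "openin T U"
  shows "openin (coset_topology G N T) ((\<lambda>x. N #>\<^bsub>G\<^esub> x) ` U)"
proof -
  interpret group G using topological_groupD(1)[OF TG] .
  note ts = topological_groupD(2)[OF TG]
  have UG: "U \<subseteq> carrier G" using openin_subset[OF U] ts by simp
  have NG: "N \<subseteq> carrier G" using subgroup.subset[OF N] .
  have "{x \<in> topspace T. N #> x \<in> (\<lambda>x. N #> x) ` U} = (\<Union>h\<in>N. {x \<in> topspace T. h \<otimes> x \<in> U})"
    (is "?L = ?R")
  proof
    show "?L \<subseteq> ?R"
    proof
      fix x assume "x \<in> ?L"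
      then obtain u where x: "x \<in> carrier G" and u: "u \<in> U" "N #> x = N #> u"
        using ts by auto
      then have uG: "u \<in> carrier G" using UG by blast
      have "u \<otimes> inv x \<in> N" using rcos_eq_iff[OF N x uG] u by simp
      moreover have "(u \<otimes> inv x) \<otimes> x = u" using x uG by (simp add: m_assoc)
      ultimately show "x \<in> ?R" using x u ts by (intro UN_I[of "u \<otimes> inv x"]) auto
    qed
    show "?R \<subseteq> ?L"
    proof
      fix x assume "x \<in> ?R"
      then obtain h where x: "x \<in> carrier G" and h: "h \<in> N" "h \<otimes> x \<in> U"
        using ts by auto
      then have "h \<in> carrier G" using NG by blast
      then have "(h \<otimes> x) \<otimes> inv x = h" using x by (simp add: m_assoc)
      then have "N #> x = N #> (h \<otimes> x)"
        using rcos_eq_iff[OF N x, of "h \<otimes> x"] x \<open>h \<in> carrier G\<close> h by simp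
      then show "x \<in> ?L" using x h ts by auto
    qed
  qed
  moreover have "openin T {x \<in> topspace T. h \<otimes> x \<in> U}" if "h \<in> N" for h
  proof (rule openin_continuous_map_preimage[OF _ U])
    have "h \<in> carrier G" using that NG by blast
    then show "continuous_map T T (\<lambda>x. h \<otimes> x)"
      using topological_group_continuous_mult[OF TG, of T "\<lambda>_. h" "\<lambda>x. x"] ts by simp
  qed
  ultimately have "openin T {x \<in> topspace T. N #> x \<in> (\<lambda>x. N #> x) ` U}" by auto
  then show ?thesis
    using openin_subset[OF U] by (auto simp: coset_topology_def openin_quotient_topology)
qed

text \<open>Both operations are continuous on \<open>T\<close> before passing to cosets, and
  continuity descends along a quotient map. Normality enters through the formulas for products and
  inverses of cosets.\<close>

lemma topological_group_Mod:
  fixes G (structure)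
  assumes TG: "topological_group G T" and N: "N \<lhd> G"
  shows "topological_group (G Mod N) (coset_topology G N T)"
proof -
  interpret normal N G by fact
  note ts = topological_groupD(2)[OF TG]
  let ?Q = "coset_topology G N T" and ?q = "\<lambda>x. N #> x"
  have sub: "subgroup N G" by (rule is_subgroup)
  have q: "quotient_map T ?Q ?q" by (rule quotient_map_coset_topology)
  have tsQ: "topspace ?Q = carrier (G Mod N)" by (simp add: carrier_FactGroup ts)
  \<comment> \<open>A product of two quotient maps need not be a quotient map. Here it is one
    because \<open>?q\<close> is open: boxes inside \<open>W\<close> are sent to open boxes inside
    the image of \<open>W\<close>.\<close>
  have "quotient_map (prod_topology T T) (prod_topology ?Q ?Q) (\<lambda>(x, y). (?q x, ?q y))"
  proof (rule continuous_open_imp_quotient_map)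
    show "continuous_map (prod_topology T T) (prod_topology ?Q ?Q) (\<lambda>(x, y). (?q x, ?q y))"
      unfolding case_prod_beta
      by (intro continuous_map_pairedI continuous_map_coset continuous_map_fst continuous_map_snd)
    show "open_map (prod_topology T T) (prod_topology ?Q ?Q) (\<lambda>(x, y). (?q x, ?q y))"
      unfolding open_map_def
    proof (intro allI impI)
      fix W assume W: "openin (prod_topology T T) W"
      show "openin (prod_topology ?Q ?Q) ((\<lambda>(x, y). (?q x, ?q y)) ` W)"
        unfolding openin_prod_topology_alt
      proof (intro allI impI)
        fix c d assume "(c, d) \<in> (\<lambda>(x, y). (?q x, ?q y)) ` W"
        then obtain x y where xy: "(x, y) \<in> W" "c = ?q x" "d = ?q y" by auto
        obtain U V where UV: "openin T U" "openin T V" "x \<in> U" "y \<in> V" "U \<times> V \<subseteq> W"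
          using openin_prod_topology_alt[THEN iffD1, rule_format, OF W xy(1)] by blast
        show "\<exists>U V. openin ?Q U \<and> openin ?Q V \<and> c \<in> U \<and> d \<in> V \<and>
            U \<times> V \<subseteq> (\<lambda>(x, y). (?q x, ?q y)) ` W"
        proof (intro exI conjI)
          show "?q ` U \<times> ?q ` V \<subseteq> (\<lambda>(x, y). (?q x, ?q y)) ` W"
            using UV(5) by force
        qed (use UV xy openin_coset_image[OF TG sub] in auto)
      qed
    qed
    show "(\<lambda>(x, y). (?q x, ?q y)) ` topspace (prod_topology T T) = topspace (prod_topology ?Q ?Q)"
      by force
  qed
  moreover have "continuous_map (prod_topology T T) ?Q
      ((\<lambda>(c, d). c \<otimes>\<^bsub>G Mod N\<^esub> d) \<circ> (\<lambda>(x, y). (?q x, ?q y)))"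
  proof (rule continuous_map_eq)
    show "continuous_map (prod_topology T T) ?Q (\<lambda>p. ?q (fst p \<otimes> snd p))"
      by (intro continuous_map_coset topological_group_continuous_mult[OF TG]
          continuous_map_fst continuous_map_snd)
    show "?q (fst p \<otimes> snd p) = ((\<lambda>(c, d). c \<otimes>\<^bsub>G Mod N\<^esub> d) \<circ> (\<lambda>(x, y). (?q x, ?q y))) p"
      if "p \<in> topspace (prod_topology T T)" for p
      using that by (auto simp: ts rcos_sum)
  qed
  ultimately have 1: "continuous_map (prod_topology ?Q ?Q) ?Q (\<lambda>(c, d). c \<otimes>\<^bsub>G Mod N\<^esub> d)"
    by (rule continuous_compose_quotient_map)
  have "continuous_map T ?Q ((\<lambda>c. inv\<^bsub>G Mod N\<^esub> c) \<circ> ?q)"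
  proof (rule continuous_map_eq)
    show "continuous_map T ?Q (\<lambda>x. ?q (inv x))"
      by (intro continuous_map_coset topological_groupD(4)[OF TG])
    show "?q (inv x) = ((\<lambda>c. inv\<^bsub>G Mod N\<^esub> c) \<circ> ?q) x" if "x \<in> topspace T" for x
      using that by (simp add: ts carrier_FactGroup inv_FactGroup rcos_inv)
  qed
  then have "continuous_map ?Q ?Q (\<lambda>c. inv\<^bsub>G Mod N\<^esub> c)"
    by (rule continuous_compose_quotient_map[OF q])
  then show ?thesis
    using 1 tsQ factorgroup_is_group by (simp add: topological_group_def)
qed

text \<open>As \<open>N\<close> is closed, the pairs that lie in different cosets form an open set
  \<open>?W\<close>. A box \<open>U\<close> times \<open>V\<close> around \<open>(x, y)\<close>
  inside \<open>?W\<close> has disjoint projections, and these are open because the projection is an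
  open map.\<close>

lemma Hausdorff_space_coset_topology:
  fixes G (structure)
  assumes TG: "topological_group G T" and N: "subgroup N G" and cl: "closedin T N"
  shows "Hausdorff_space (coset_topology G N T)"
  unfolding Hausdorff_space_def
proof (intro allI impI, elim conjE)
  interpret group G using topological_groupD(1)[OF TG] .
  note ts = topological_groupD(2)[OF TG]
  fix c d assume "c \<in> topspace (coset_topology G N T)" "d \<in> topspace (coset_topology G N T)" "c \<noteq> d"
  then obtain x y where xy: "x \<in> carrier G" "y \<in> carrier G" "c = N #> x" "d = N #> y" "N #> x \<noteq> N #> y"
    using ts by auto
  let ?W = "{p \<in> topspace (prod_topology T T). snd p \<otimes> inv (fst p) \<in> topspace T - N}"
  have "openin (prod_topology T T) ?W"
    by (intro openin_continuous_map_preimage[of _ T] topological_group_continuous_mult[OF TG]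
        topological_group_continuous_inv[OF TG] continuous_map_fst continuous_map_snd)
      (use cl in auto)
  moreover have "(x, y) \<in> ?W"
    using xy rcos_eq_iff[OF N] by (auto simp: ts)
  ultimately obtain U V where UV: "openin T U" "openin T V" "x \<in> U" "y \<in> V" "U \<times> V \<subseteq> ?W"
    unfolding openin_prod_topology_alt by meson
  have "disjnt ((\<lambda>x. N #> x) ` U) ((\<lambda>x. N #> x) ` V)"
  proof -
    have "N #> u \<noteq> N #> v" if "u \<in> U" "v \<in> V" for u v
    proof -
      have "(u, v) \<in> ?W" using UV(5) that by blast
      then show ?thesis using rcos_eq_iff[OF N, of u v] by (auto simp: ts)
    qed
    then show ?thesis by (auto simp: disjnt_iff)
  qed
  then show "\<exists>U V. openin (coset_topology G N T) U \<and> openin (coset_topology G N T) V \<and>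
      c \<in> U \<and> d \<in> V \<and> disjnt U V"
    using UV xy openin_coset_image[OF TG N] by blast
qed

lemma topological_group_DirProd:
  assumes G: "topological_group G T" and H: "topological_group H U"
  shows "topological_group (G \<times>\<times> H) (prod_topology T U)"
proof -
  note g = topological_groupD[OF G] and h = topological_groupD[OF H]
  let ?P = "prod_topology T U"
  have "continuous_map (prod_topology ?P ?P) ?P
      (\<lambda>p. (fst (fst p) \<otimes>\<^bsub>G\<^esub> fst (snd p), snd (fst p) \<otimes>\<^bsub>H\<^esub> snd (snd p)))"
    by (intro continuous_map_pairedI topological_group_continuous_mult[OF G]
        topological_group_continuous_mult[OF H]
        continuous_map_compose[OF continuous_map_fst continuous_map_fst, unfolded o_def]
        continuous_map_compose[OF continuous_map_snd continuous_map_fst, unfolded o_def]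
        continuous_map_compose[OF continuous_map_fst continuous_map_snd, unfolded o_def]
        continuous_map_compose[OF continuous_map_snd continuous_map_snd, unfolded o_def])
  then have 1: "continuous_map (prod_topology ?P ?P) ?P (\<lambda>(x, y). x \<otimes>\<^bsub>G \<times>\<times> H\<^esub> y)"
    by (simp add: case_prod_unfold mult_DirProd')
  have "continuous_map ?P ?P (\<lambda>x. inv\<^bsub>G \<times>\<times> H\<^esub> x)"
  proof (rule continuous_map_eq)
    show "continuous_map ?P ?P (\<lambda>p. (inv\<^bsub>G\<^esub> fst p, inv\<^bsub>H\<^esub> snd p))"
      by (intro continuous_map_pairedI topological_group_continuous_inv[OF G]
        topological_group_continuous_inv[OF H] continuous_map_fst continuous_map_snd)
    show "(inv\<^bsub>G\<^esub> fst p, inv\<^bsub>H\<^esub> snd p) = inv\<^bsub>G \<times>\<times> H\<^esub> p" if "p \<in> topspace ?P" for p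
      using that g(1,2) h(1,2) by auto
  qed
  then show ?thesis
    using 1 g(1,2) h(1,2) by (simp add: topological_group_def DirProd_group)
qed

section \<open>Limits under divisibility\<close>

lemma divlim_carrierD:
  assumes "x \<in> divlim_carrier G p"
  shows "x \<in> (\<Pi>\<^sub>E n\<in>{0<..}. carrier (G n))"
    and "\<And>n. 0 < n \<Longrightarrow> x n \<in> carrier (G n)"
    and "\<And>n m. 0 < n \<Longrightarrow> 0 < m \<Longrightarrow> n dvd m \<Longrightarrow> p n (x m) = x n"
  using assms by (auto simp: divlim_carrier_def)

lemma carrier_divlim_group [simp]: "carrier (divlim_group G p) = divlim_carrier G p"
  by (simp add: divlim_group_def)

lemma mult_divlim_group [simp]:
  "x \<otimes>\<^bsub>divlim_group G p\<^esub> y = (\<lambda>n\<in>{0<..}. x n \<otimes>\<^bsub>G n\<^esub> y n)"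
  by (simp add: divlim_group_def)

lemma one_divlim_group [simp]: "\<one>\<^bsub>divlim_group G p\<^esub> = (\<lambda>n\<in>{0<..}. \<one>\<^bsub>G n\<^esub>)"
  by (simp add: divlim_group_def)

text \<open>The compatibility conditions survive products and inverses because the transition maps
  are homomorphisms. The group axioms of the limit are then inherited from the full product.\<close>

lemma subgroup_divlim_carrier:
  assumes G: "\<And>n. 0 < n \<Longrightarrow> group (G n)"
    and p: "\<And>n m. 0 < n \<Longrightarrow> 0 < m \<Longrightarrow> n dvd m \<Longrightarrow> p n \<in> hom (G m) (G n)"
  shows "subgroup (divlim_carrier G p) (product_group {0<..} G)"
proof
  show "divlim_carrier G p \<subseteq> carrier (product_group {0<..} G)"
    by (auto simp: divlim_carrier_def)
next
  fix x y assume x: "x \<in> divlim_carrier G p" and y: "y \<in> divlim_carrier G p"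
  have "p n (x m \<otimes>\<^bsub>G m\<^esub> y m) = x n \<otimes>\<^bsub>G n\<^esub> y n" if "0 < n" "0 < m" "n dvd m" for n m
    using that divlim_carrierD(2,3)[OF x] divlim_carrierD(2,3)[OF y] hom_mult[OF p[OF that]]
    by simp
  then show "x \<otimes>\<^bsub>product_group {0<..} G\<^esub> y \<in> divlim_carrier G p"
    using divlim_carrierD(2)[OF x] divlim_carrierD(2)[OF y] G
    by (auto simp: divlim_carrier_def group.is_monoid intro!: monoid.m_closed)
next
  show "\<one>\<^bsub>product_group {0<..} G\<^esub> \<in> divlim_carrier G p"
    using G p by (auto simp: divlim_carrier_def group.is_monoid hom_one)
next
  fix x assume x: "x \<in> divlim_carrier G p"
  have "p n (inv\<^bsub>G m\<^esub> (x m)) = inv\<^bsub>G n\<^esub> (x n)" if "0 < n" "0 < m" "n dvd m" for n m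
    using that group_hom.hom_inv[of "G m" "G n" "p n" "x m"] divlim_carrierD(2,3)[OF x] G p
    by (simp add: group_hom_def group_hom_axioms_def)
  moreover have "inv\<^bsub>product_group {0<..} G\<^esub> x = (\<lambda>n\<in>{0<..}. inv\<^bsub>G n\<^esub> (x n))"
    by (rule inv_product_group[OF divlim_carrierD(1)[OF x]]) (use G in simp)
  ultimately show "inv\<^bsub>product_group {0<..} G\<^esub> x \<in> divlim_carrier G p"
    using divlim_carrierD(2)[OF x] G
    by (auto simp: divlim_carrier_def)
qed

lemma topspace_divlim_topology:
  assumes "\<And>n. 0 < n \<Longrightarrow> topspace (T n) = carrier (G n)"
  shows "topspace (divlim_topology G T p) = divlim_carrier G p"
proof -
  have "(\<Pi>\<^sub>E n\<in>{0<..}. topspace (T n)) = (\<Pi>\<^sub>E n\<in>{0<..}. carrier (G n))"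
    using assms by (intro PiE_cong) auto
  then show ?thesis
    by (auto simp: divlim_topology_def divlim_carrier_def)
qed

lemma continuous_map_divlim_component:
  assumes "0 < n"
  shows "continuous_map (divlim_topology G T p) (T n) (\<lambda>x. x n)"
  unfolding divlim_topology_def
  using assms by (intro continuous_map_from_subtopology continuous_map_product_projection) auto

text \<open>The universal property of the limit topology. The second hypothesis also makes the
  values of \<open>f\<close> extensional, as the product topology requires.\<close>

lemma continuous_map_into_divlim:
  assumes "\<And>n. 0 < n \<Longrightarrow> continuous_map Z (T n) (\<lambda>z. f z n)"
    and "f \<in> topspace Z \<rightarrow> divlim_carrier G p"
  shows "continuous_map Z (divlim_topology G T p) f"
  unfolding divlim_topology_def continuous_map_in_subtopology continuous_map_componentwise
  using assms by (fastforce simp: divlim_carrier_def PiE_def)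

lemma topological_group_divlim:
  assumes TG: "\<And>n. 0 < n \<Longrightarrow> topological_group (G n) (T n)"
    and p: "\<And>n m. 0 < n \<Longrightarrow> 0 < m \<Longrightarrow> n dvd m \<Longrightarrow> p n \<in> hom (G m) (G n)"
  shows "topological_group (divlim_group G p) (divlim_topology G T p)"
proof -
  let ?G = "divlim_group G p" and ?T = "divlim_topology G T p"
  have G: "\<And>n. 0 < n \<Longrightarrow> group (G n)" and ts: "\<And>n. 0 < n \<Longrightarrow> topspace (T n) = carrier (G n)"
    using topological_groupD[OF TG] by auto
  have P: "group (product_group {0<..} G)" by (rule product_group) (use G in simp)
  have sub: "subgroup (divlim_carrier G p) (product_group {0<..} G)"
    using G p by (rule subgroup_divlim_carrier)
  have grp: "group ?G"
    unfolding divlim_group_def by (rule subgroup.subgroup_is_group[OF sub P])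
  have tsl: "topspace ?T = divlim_carrier G p"
    using ts by (rule topspace_divlim_topology)
  have "continuous_map (prod_topology ?T ?T) ?T (\<lambda>q. fst q \<otimes>\<^bsub>?G\<^esub> snd q)"
  proof (rule continuous_map_into_divlim)
    fix n :: nat assume n: "0 < n"
    have "continuous_map (prod_topology ?T ?T) (T n) (\<lambda>q. fst q n \<otimes>\<^bsub>G n\<^esub> snd q n)"
      using continuous_map_compose[OF continuous_map_fst continuous_map_divlim_component[OF n], unfolded o_def]
        continuous_map_compose[OF continuous_map_snd continuous_map_divlim_component[OF n], unfolded o_def]
      by (rule topological_group_continuous_mult[OF TG[OF n]])
    then show "continuous_map (prod_topology ?T ?T) (T n) (\<lambda>q. (fst q \<otimes>\<^bsub>?G\<^esub> snd q) n)"
      using n by simp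
  next
    show "(\<lambda>q. fst q \<otimes>\<^bsub>?G\<^esub> snd q) \<in> topspace (prod_topology ?T ?T) \<rightarrow> divlim_carrier G p"
      using monoid.m_closed[OF group.is_monoid[OF grp]] tsl by auto
  qed
  then have 1: "continuous_map (prod_topology ?T ?T) ?T (\<lambda>(x, y). x \<otimes>\<^bsub>?G\<^esub> y)"
    by (simp only: case_prod_unfold)
  \<comment> \<open>The inverse is defined relative to a carrier, so that of the limit has to be
    identified with that of the ambient product before it can be computed label by label.\<close>
  have inv: "inv\<^bsub>?G\<^esub> x = (\<lambda>n\<in>{0<..}. inv\<^bsub>G n\<^esub> (x n))" if "x \<in> divlim_carrier G p" for x
  proof -
    have "inv\<^bsub>?G\<^esub> x = inv\<^bsub>product_group {0<..} G\<^esub> x"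
      unfolding divlim_group_def by (rule group.m_inv_consistent[OF P sub that])
    also have "\<dots> = (\<lambda>n\<in>{0<..}. inv\<^bsub>G n\<^esub> (x n))"
      by (rule inv_product_group[OF divlim_carrierD(1)[OF that]]) (use G in simp)
    finally show ?thesis .
  qed
  have 2: "continuous_map ?T ?T (\<lambda>x. inv\<^bsub>?G\<^esub> x)"
  proof (rule continuous_map_into_divlim)
    fix n :: nat assume n: "0 < n"
    show "continuous_map ?T (T n) (\<lambda>x. (inv\<^bsub>?G\<^esub> x) n)"
    proof (rule continuous_map_eq)
      show "continuous_map ?T (T n) (\<lambda>x. inv\<^bsub>G n\<^esub> (x n))"
        by (intro topological_group_continuous_inv[OF TG[OF n]] continuous_map_divlim_component n)
    qed (use inv tsl n in simp)
  next
    show "(\<lambda>x. inv\<^bsub>?G\<^esub> x) \<in> topspace ?T \<rightarrow> divlim_carrier G p"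
      using group.inv_closed[OF grp] tsl by auto
  qed
  show ?thesis
    using grp tsl 1 2 by (simp add: topological_group_def)
qed

lemma Hausdorff_space_divlim:
  assumes "\<And>n. 0 < n \<Longrightarrow> Hausdorff_space (T n)"
  shows "Hausdorff_space (divlim_topology G T p)"
  unfolding divlim_topology_def
  using assms by (intro Hausdorff_space_subtopology) (simp add: Hausdorff_space_product_topology)

text \<open>By Tychonoff the product is compact. The limit is closed in it, being an intersection of
  equalizers of continuous maps into Hausdorff spaces.\<close>

lemma compact_space_divlim:
  assumes ts: "\<And>n. 0 < n \<Longrightarrow> topspace (T n) = carrier (G n)"
    and T: "\<And>n. 0 < n \<Longrightarrow> compact_space (T n)" "\<And>n. 0 < n \<Longrightarrow> Hausdorff_space (T n)"
    and p: "\<And>n m. 0 < n \<Longrightarrow> 0 < m \<Longrightarrow> n dvd m \<Longrightarrow> continuous_map (T m) (T n) (p n)"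
  shows "compact_space (divlim_topology G T p)"
proof -
  let ?P = "product_topology T {0<..}"
  let ?I = "{(n :: nat, m :: nat). 0 < n \<and> 0 < m \<and> n dvd m}"
  let ?E = "\<lambda>(n, m). {x \<in> topspace ?P. p n (x m) = x n}"
  have PE: "(\<Pi>\<^sub>E n\<in>{0<..}. topspace (T n)) = (\<Pi>\<^sub>E n\<in>{0<..}. carrier (G n))"
    using ts by (intro PiE_cong) auto
  \<comment> \<open>A nonempty index set is needed twice: to make members of the intersection lie in
    the product, and to have the intersection closed.\<close>
  have I1: "(1, 1) \<in> ?I" by simp
  have "divlim_carrier G p = (\<Inter>i\<in>?I. ?E i)"
  proof (rule Set.set_eqI)
    fix x
    have "x \<in> (\<Inter>i\<in>?I. ?E i) \<longleftrightarrow> (\<forall>i\<in>?I. x \<in> topspace ?P) \<and> (\<forall>(n, m)\<in>?I. p n (x m) = x n)"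
      by auto
    also have "\<dots> \<longleftrightarrow> x \<in> topspace ?P \<and> (\<forall>(n, m)\<in>?I. p n (x m) = x n)"
      using I1 by blast
    also have "\<dots> \<longleftrightarrow> x \<in> divlim_carrier G p"
      unfolding divlim_carrier_def topspace_product_topology PE by auto
    finally show "x \<in> divlim_carrier G p \<longleftrightarrow> x \<in> (\<Inter>i\<in>?I. ?E i)" by (rule sym)
  qed
  moreover have "closedin ?P (\<Inter>i\<in>?I. ?E i)"
  proof (rule closedin_INT)
    show "?I \<noteq> {}" using I1 by blast
    fix i assume "i \<in> ?I"
    then obtain n m where i: "i = (n, m)" "0 < n" "0 < m" "n dvd m" by blast
    have "continuous_map ?P (T n) (\<lambda>x. p n (x m))"
      using continuous_map_compose[OF continuous_map_product_projection[of m "{0<..}" T] p[OF i(2-4)]] i(3)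
      by (simp add: o_def)
    moreover have "continuous_map ?P (T n) (\<lambda>x. x n)"
      using i(2) by (intro continuous_map_product_projection) simp
    ultimately show "closedin ?P (?E i)"
      using closedin_continuous_maps_eq[OF T(2)[OF i(2)]] by (simp only: i(1) prod.case)
  qed
  moreover have "compact_space ?P"
    using T(1) by (simp add: compact_space_product_topology)
  ultimately show ?thesis
    unfolding divlim_topology_def
    by (simp add: closedin_compact_space compact_space_subtopology)
qed

text \<open>A subset of the limit is dense as soon as it reaches every value at every single label, because
  the value at a common multiple of finitely many labels determines the values at these labels.\<close>

lemma closure_of_divlim:
  assumes ts: "\<And>n. 0 < n \<Longrightarrow> topspace (T n) = carrier (G n)"
    and A: "A \<subseteq> divlim_carrier G p"
    and ex: "\<And>c N. c \<in> divlim_carrier G p \<Longrightarrow> 0 < N \<Longrightarrow> \<exists>a\<in>A. a N = c N"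
  shows "divlim_topology G T p closure_of A = divlim_carrier G p"
proof
  have tsl: "topspace (divlim_topology G T p) = divlim_carrier G p"
    using ts by (rule topspace_divlim_topology)
  then show "divlim_topology G T p closure_of A \<subseteq> divlim_carrier G p"
    using closure_of_subset_topspace by metis
  show "divlim_carrier G p \<subseteq> divlim_topology G T p closure_of A"
  proof
    fix c assume c: "c \<in> divlim_carrier G p"
    have "\<exists>y. y \<in> A \<and> y \<in> W" if W: "c \<in> W" "openin (divlim_topology G T p) W" for W
    proof -
      obtain S where S: "openin (product_topology T {0<..}) S" "W = S \<inter> divlim_carrier G p"
        using W(2) unfolding divlim_topology_def openin_subtopology by blast
      have "c \<in> S" using W(1) S(2) by blast
      then obtain U where U: "finite {i \<in> {0<..}. U i \<noteq> topspace (T i)}" "c \<in> Pi\<^sub>E {0<..} U" "Pi\<^sub>E {0<..} U \<subseteq> S"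
        using S(1) unfolding openin_product_topology_alt by meson
      let ?F = "{i \<in> {0<..}. U i \<noteq> topspace (T i)}"
      \<comment> \<open>\<open>?F\<close> collects the finitely many labels that the basic open set
        really constrains. If there are none, the empty product still gives the valid label
        1.\<close>
      define N where "N = \<Prod>?F"
      have N: "0 < N" unfolding N_def by (intro prod_pos) simp
      then obtain a where a: "a \<in> A" "a N = c N" using ex[OF c] by blast
      have aL: "a \<in> divlim_carrier G p" using a A by blast
      have "a i \<in> U i" if i: "0 < i" for i
      proof (cases "i \<in> ?F")
        case True
        then have "i dvd N" unfolding N_def using U(1) by (rule dvd_prodI[where f = "\<lambda>x. x", rotated])
        then have "a i = c i"
          using divlim_carrierD(3)[OF aL i N] divlim_carrierD(3)[OF c i N] a(2) by simp
        then show ?thesis using U(2) i by auto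
      next
        case False
        then show ?thesis using i ts divlim_carrierD(2)[OF aL i] by simp
      qed
      then have "a \<in> Pi\<^sub>E {0<..} U" using divlim_carrierD(1)[OF aL] by (auto simp: PiE_def)
      then show ?thesis using a(1) aL U(3) S(2) by blast
    qed
    then show "c \<in> divlim_topology G T p closure_of A"
      using c tsl by (simp add: in_closure_of)
  qed
qed

text \<open>Checked on representatives, where the projection only replaces \<open>H\<close> by
  \<open>K\<close>. This supplies the homomorphism hypothesis on the transition maps for both
  limits.\<close>

lemma coset_projection_hom:
  fixes G (structure)
  assumes H: "H \<lhd> G" and K: "K \<lhd> G" and HK: "H \<subseteq> K"
  shows "coset_projection G K \<in> hom (G Mod H) (G Mod K)"
proof -
  interpret H: normal H G by fact
  interpret K: normal K G by fact
  note cp = coset_projection_coset[OF H.is_group H.is_subgroup K.is_subgroup HK]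
  show ?thesis
  proof (rule homI)
    fix C assume "C \<in> carrier (G Mod H)"
    then obtain x where x: "x \<in> carrier G" "C = H #> x" by (auto simp: carrier_FactGroup)
    then show "coset_projection G K C \<in> carrier (G Mod K)"
      by (simp add: cp carrier_FactGroup)
    fix D assume "D \<in> carrier (G Mod H)"
    then obtain y where y: "y \<in> carrier G" "D = H #> y" by (auto simp: carrier_FactGroup)
    show "coset_projection G K (C \<otimes>\<^bsub>G Mod H\<^esub> D) =
        coset_projection G K C \<otimes>\<^bsub>G Mod K\<^esub> coset_projection G K D"
      using x y by (simp add: cp H.rcos_sum K.rcos_sum)
  qed
qed

section \<open>Circles and profinite integers\<close>

lemma carrier_real_group [simp]: "carrier real_group = UNIV"
  and mult_real_group [simp]: "x \<otimes>\<^bsub>real_group\<^esub> y = x + y"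
  and one_real_group [simp]: "\<one>\<^bsub>real_group\<^esub> = 0"
  by (simp_all add: real_group_def)

lemma group_real_group [simp]: "group real_group"
  by (rule groupI) (auto intro: exI[of _ "- x" for x :: real] simp: add.assoc)

lemma inv_real_group [simp]: "inv\<^bsub>real_group\<^esub> x = - x"
  by (rule group.inv_equality) auto

lemma comm_group_real_group: "comm_group real_group"
  by (rule group.group_comm_groupI) auto

lemma topological_group_real_group: "topological_group real_group euclideanreal"
proof -
  have "continuous_map (prod_topology euclideanreal euclideanreal) euclideanreal (\<lambda>p. fst p + snd p)"
    by (intro continuous_map_add continuous_map_fst continuous_map_snd)
  moreover have "continuous_map euclideanreal euclideanreal (\<lambda>x. - x)"
    by (intro continuous_map_minus) simp
  ultimately show ?thesis
    by (simp add: topological_group_def case_prod_unfold)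
qed

lemma real_multiples_normal: "real_multiples n \<lhd> real_group"
proof -
  have "subgroup (real_multiples n) real_group"
  proof
    fix x y assume "x \<in> real_multiples n" "y \<in> real_multiples n"
    then show "x \<otimes>\<^bsub>real_group\<^esub> y \<in> real_multiples n"
      unfolding real_multiples_def by (auto simp flip: distrib_left of_int_add)
  next
    fix x assume "x \<in> real_multiples n"
    then show "inv\<^bsub>real_group\<^esub> x \<in> real_multiples n"
      unfolding real_multiples_def by (auto simp flip: of_int_minus mult_minus_right)
  qed (auto simp: real_multiples_def intro: range_eqI[of _ _ 0])
  then show ?thesis
    by (simp add: comm_group.normal_iff_subgroup[OF comm_group_real_group])
qed

lemma int_multiples_normal: "int_multiples n \<lhd> integer_group"
proof -
  have "subgroup (int_multiples n) integer_group"
  proof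
    fix x y assume "x \<in> int_multiples n" "y \<in> int_multiples n"
    then show "x \<otimes>\<^bsub>integer_group\<^esub> y \<in> int_multiples n"
      unfolding int_multiples_def by (auto simp flip: distrib_left)
  next
    fix x assume "x \<in> int_multiples n"
    then show "inv\<^bsub>integer_group\<^esub> x \<in> int_multiples n"
      unfolding int_multiples_def by (auto simp flip: mult_minus_right)
  qed (auto simp: int_multiples_def intro: range_eqI[of _ _ 0])
  then show ?thesis
    by (simp add: comm_group.normal_iff_subgroup[OF abelian_integer_group])
qed

lemmas real_multiples_subgroup = normal_imp_subgroup[OF real_multiples_normal]
lemmas int_multiples_subgroup = normal_imp_subgroup[OF int_multiples_normal]

lemma real_multiples_mono:
  assumes "n dvd m"
  shows "real_multiples m \<subseteq> real_multiples n"
proof -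
  obtain d where "m = n * d" using assms by blast
  then have "real m * of_int k = real n * of_int (int d * k)" for k by simp
  then show ?thesis unfolding real_multiples_def by blast
qed

lemma int_multiples_mono:
  assumes "n dvd m"
  shows "int_multiples m \<subseteq> int_multiples n"
proof -
  obtain d where "m = n * d" using assms by blast
  then have "int m * k = int n * (int d * k)" for k by simp
  then show ?thesis unfolding int_multiples_def by blast
qed

lemma real_coset_eq_iff:
  "real_multiples n #>\<^bsub>real_group\<^esub> x = real_multiples n #>\<^bsub>real_group\<^esub> y \<longleftrightarrow> y - x \<in> real_multiples n"
  using group.rcos_eq_iff[OF group_real_group real_multiples_subgroup, of x y n] by simp

lemma int_coset_eq_iff:
  "int_multiples n #>\<^bsub>integer_group\<^esub> k = int_multiples n #>\<^bsub>integer_group\<^esub> l \<longleftrightarrow> l - k \<in> int_multiples n"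
  using group.rcos_eq_iff[OF group_integer_group int_multiples_subgroup, of k l n] by simp

lemma mem_int_coset_iff:
  "l \<in> int_multiples n #>\<^bsub>integer_group\<^esub> k \<longleftrightarrow> l - k \<in> int_multiples n"
  using subgroup.rcos_module[OF int_multiples_subgroup group_integer_group, of k l n] by simp

lemma mem_int_multiples_iff: "k \<in> int_multiples n \<longleftrightarrow> int n dvd k"
  by (auto simp: int_multiples_def dvd_def)

text \<open>This is the injectivity of Z/nZ into R/nZ. It links the two towers: well-definedness,
  surjectivity and the kernel of the map to the limit all rest on it.\<close>

lemma of_int_mem_real_multiples_iff: "of_int k \<in> real_multiples n \<longleftrightarrow> k \<in> int_multiples n"
proof -
  have "(real_of_int k = real n * of_int j) \<longleftrightarrow> k = int n * j" for j
    by (simp flip: of_int_eq_iff[where ?'a = real])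
  then show ?thesis by (auto simp: real_multiples_def int_multiples_def)
qed

lemma closed_real_multiples: "closed (real_multiples n)"
proof -
  have "closed ((\<lambda>x. real n *\<^sub>R x) ` range (of_int :: int \<Rightarrow> real))"
    by (intro closed_scaling closed_of_int_image)
  also have "(\<lambda>x. real n *\<^sub>R x) ` range (of_int :: int \<Rightarrow> real) = real_multiples n"
    by (auto simp: real_multiples_def)
  finally show ?thesis .
qed

section \<open>The circles as compact groups\<close>

lemma topspace_circle_topology: "topspace (circle_topology n) = carrier (circle_group n)"
  by (simp add: circle_topology_def circle_group_def carrier_FactGroup)

lemma circle_coset_in_carrier [simp]:
  "real_multiples n #>\<^bsub>real_group\<^esub> x \<in> carrier (circle_group n)"
  by (simp add: circle_group_def carrier_FactGroup)

text \<open>The circle is the continuous image of the compact interval from 0 to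
  \<open>n\<close>.\<close>

lemma compact_space_circle:
  assumes n: "0 < n"
  shows "compact_space (circle_topology n)"
proof -
  let ?q = "\<lambda>x. real_multiples n #>\<^bsub>real_group\<^esub> x"
  have "compactin (circle_topology n) (?q ` {0..real n})"
    unfolding circle_topology_def
    by (rule image_compactin[OF _ quotient_imp_continuous_map[OF quotient_map_coset_topology]]) simp
  moreover have "range ?q \<subseteq> ?q ` {0..real n}"
  proof clarify
    fix x :: real
    \<comment> \<open>Subtracting \<open>n\<close> times this integer part moves \<open>x\<close>
      into the interval without changing its class.\<close>
    define k where "k = \<lfloor>x / real n\<rfloor>"
    have "of_int k \<le> x / real n" "x / real n \<le> of_int k + 1" unfolding k_def by linarith+
    then have "x - real n * of_int k \<in> {0..real n}"
      using n by (auto simp: field_simps)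
    moreover have "?q x = ?q (x - real n * of_int k)"
      unfolding real_coset_eq_iff by (simp add: real_multiples_def range_eqI[of _ _ "- k"])
    ultimately show "?q x \<in> ?q ` {0..real n}" by blast
  qed
  then have "?q ` {0..real n} = topspace (circle_topology n)"
    by (auto simp: circle_topology_def)
  ultimately show ?thesis by (simp add: compact_space_def)
qed

lemma compact_group_circle:
  assumes "0 < n"
  shows "compact_group (circle_group n) (circle_topology n)"
  unfolding compact_group_def
proof (intro conjI)
  show "topological_group (circle_group n) (circle_topology n)"
    unfolding circle_group_def circle_topology_def
    by (rule topological_group_Mod[OF topological_group_real_group real_multiples_normal])
  show "compact_space (circle_topology n)"
    using assms by (rule compact_space_circle)
  show "Hausdorff_space (circle_topology n)"
    unfolding circle_topology_def
    using closed_real_multiples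
    by (intro Hausdorff_space_coset_topology topological_group_real_group real_multiples_subgroup) simp
qed

lemma circle_proj_coset:
  assumes "n dvd m"
  shows "circle_proj n (real_multiples m #>\<^bsub>real_group\<^esub> x) = real_multiples n #>\<^bsub>real_group\<^esub> x"
  unfolding circle_proj_def
  using assms by (intro coset_projection_coset real_multiples_subgroup real_multiples_mono) auto

lemma int_mod_proj_coset:
  assumes "n dvd m"
  shows "int_mod_proj n (int_multiples m #>\<^bsub>integer_group\<^esub> k) = int_multiples n #>\<^bsub>integer_group\<^esub> k"
  unfolding int_mod_proj_def
  using assms by (intro coset_projection_coset int_multiples_subgroup int_multiples_mono) auto

lemma circle_proj_hom:
  assumes "n dvd m"
  shows "circle_proj n \<in> hom (circle_group m) (circle_group n)"
  unfolding circle_proj_def circle_group_def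
  using assms by (intro coset_projection_hom real_multiples_normal real_multiples_mono)

lemma int_mod_proj_hom:
  assumes "n dvd m"
  shows "int_mod_proj n \<in> hom (int_mod_group m) (int_mod_group n)"
  unfolding int_mod_proj_def int_mod_group_def
  using assms by (intro coset_projection_hom int_multiples_normal int_multiples_mono)

section \<open>The finite groups Z/nZ and the profinite integers\<close>

lemma topological_group_discrete:
  assumes "group G"
  shows "topological_group G (discrete_topology (carrier G))"
proof -
  interpret group G by fact
  show ?thesis
    by (auto simp: topological_group_def is_group simp flip: prod_topology_discrete_topology)
qed

text \<open>The remainders modulo \<open>n\<close> represent all classes. Finiteness makes the
  discrete topology compact, which is what the compactness of \<open>Zhat\<close> needs.\<close>

lemma finite_carrier_int_mod_group:
  assumes "0 < n"
  shows "finite (carrier (int_mod_group n))"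
proof -
  have "int_multiples n #>\<^bsub>integer_group\<^esub> k
      \<in> (\<lambda>k. int_multiples n #>\<^bsub>integer_group\<^esub> k) ` {0..<int n}" for k
  proof
    show "int_multiples n #>\<^bsub>integer_group\<^esub> k = int_multiples n #>\<^bsub>integer_group\<^esub> (k mod int n)"
      unfolding int_coset_eq_iff mem_int_multiples_iff by (simp flip: mod_eq_dvd_iff)
    show "k mod int n \<in> {0..<int n}" using assms by simp
  qed
  then have "carrier (int_mod_group n) \<subseteq> (\<lambda>k. int_multiples n #>\<^bsub>integer_group\<^esub> k) ` {0..<int n}"
    by (auto simp: int_mod_group_def carrier_FactGroup)
  then show ?thesis by (rule finite_subset) simp
qed

lemma carrier_Zhat: "carrier Zhat = divlim_carrier int_mod_group int_mod_proj"
  by (simp add: Zhat_def)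

lemma topological_group_int_mod: "topological_group (int_mod_group n) (int_mod_topology n)"
  unfolding int_mod_topology_def
  by (rule topological_group_discrete)
    (simp add: int_mod_group_def normal.factorgroup_is_group[OF int_multiples_normal])

lemma topological_group_Zhat: "topological_group Zhat Zhat_topology"
  unfolding Zhat_def Zhat_topology_def
  by (intro topological_group_divlim topological_group_int_mod int_mod_proj_hom)

lemma compact_space_Zhat: "compact_space Zhat_topology"
  unfolding Zhat_topology_def
proof (rule compact_space_divlim)
  show "continuous_map (int_mod_topology m) (int_mod_topology n) (int_mod_proj n)" if "n dvd m" for n m
    using int_mod_proj_hom[OF that] by (auto simp: int_mod_topology_def hom_def)
qed (simp_all add: int_mod_topology_def compact_space_discrete_topology finite_carrier_int_mod_group)

section \<open>The limit of the circles\<close>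

lemma carrier_circle_limit: "carrier circle_limit = divlim_carrier circle_group circle_proj"
  by (simp add: circle_limit_def)

lemma topspace_circle_limit: "topspace circle_limit_topology = carrier circle_limit"
  unfolding circle_limit_topology_def carrier_circle_limit
  by (intro topspace_divlim_topology topspace_circle_topology)

lemma group_circle_limit: "group circle_limit"
proof -
  have "topological_group circle_limit circle_limit_topology"
    unfolding circle_limit_def circle_limit_topology_def
    using compact_group_circle
    by (intro topological_group_divlim circle_proj_hom) (auto simp: compact_group_def)
  then show ?thesis by (rule topological_groupD)
qed

lemma Hausdorff_space_circle_limit: "Hausdorff_space circle_limit_topology"
  unfolding circle_limit_topology_def
  using compact_group_circle by (intro Hausdorff_space_divlim) (simp add: compact_group_def)

lemma connected_space_circle_limit: "connected_space circle_limit_topology"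
proof -
  \<comment> \<open>The map from the reals to the limit that takes \<open>x\<close> to its class at
    every label; its image is connected, hence so is the closure of this image.\<close>
  let ?d = "\<lambda>x. \<lambda>n\<in>{0<..}. real_multiples n #>\<^bsub>real_group\<^esub> x"
  have d: "?d x \<in> carrier circle_limit" for x
    by (auto simp: carrier_circle_limit divlim_carrier_def circle_proj_coset)
  have "continuous_map euclideanreal circle_limit_topology ?d"
    unfolding circle_limit_topology_def
  proof (rule continuous_map_into_divlim)
    fix n :: nat assume "0 < n"
    then show "continuous_map euclideanreal (circle_topology n) (\<lambda>x. ?d x n)"
      using quotient_imp_continuous_map[OF quotient_map_coset_topology] by (simp add: circle_topology_def)
  qed (use d in \<open>simp add: carrier_circle_limit\<close>)
  then have "connectedin circle_limit_topology (range ?d)"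
    by (rule connectedin_continuous_map_image) simp
  then have "connectedin circle_limit_topology (circle_limit_topology closure_of range ?d)"
    by (rule connectedin_closure_of)
  moreover have "circle_limit_topology closure_of range ?d = topspace circle_limit_topology"
    unfolding topspace_circle_limit carrier_circle_limit unfolding circle_limit_topology_def
  proof (rule closure_of_divlim)
    show "range ?d \<subseteq> divlim_carrier circle_group circle_proj"
      using d by (auto simp only: carrier_circle_limit)
    fix c and N :: nat assume "c \<in> divlim_carrier circle_group circle_proj" "0 < N"
    then have "c N \<in> carrier (circle_group N)" by (rule divlim_carrierD(2))
    \<comment> \<open>Density asks for agreement with \<open>c\<close> at the single label
      \<open>N\<close> only, so any real representative of \<open>c N\<close> will do.\<close>
    then obtain x where "c N = real_multiples N #>\<^bsub>real_group\<^esub> x"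
      by (auto simp: circle_group_def carrier_FactGroup)
    then have "?d x N = c N" using \<open>0 < N\<close> by simp
    then show "\<exists>a\<in>range ?d. a N = c N" by blast
  qed (rule topspace_circle_topology)
  ultimately show ?thesis by (simp add: connectedin_topspace)
qed

section \<open>The isomorphism\<close>

lemma Zhat_componentE:
  assumes "a \<in> carrier Zhat" and "0 < n"
  obtains k where "a n = int_multiples n #>\<^bsub>integer_group\<^esub> k" and "k \<in> a n"
proof -
  have "a n \<in> carrier (int_mod_group n)"
    using assms by (simp add: carrier_Zhat divlim_carrierD(2))
  then obtain k where k: "a n = int_multiples n #>\<^bsub>integer_group\<^esub> k"
    by (auto simp: int_mod_group_def carrier_FactGroup)
  moreover have "k \<in> a n" unfolding k mem_int_coset_iff mem_int_multiples_iff by simp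
  ultimately show ?thesis by (rule that)
qed

lemma Zhat_component_eq:
  assumes "a \<in> carrier Zhat" and "0 < n" and "k \<in> a n"
  shows "a n = int_multiples n #>\<^bsub>integer_group\<^esub> k"
proof -
  obtain l where l: "a n = int_multiples n #>\<^bsub>integer_group\<^esub> l"
    using assms(1,2) by (rule Zhat_componentE)
  then have "k - l \<in> int_multiples n" using assms(3) by (simp only: mem_int_coset_iff)
  then show ?thesis unfolding l int_coset_eq_iff .
qed

text \<open>As sets of integers, the components shrink along divisibility. One integer chosen at a
  label therefore serves at all its divisors.\<close>

lemma Zhat_component_compat:
  assumes a: "a \<in> carrier Zhat" and "0 < n" "0 < m" "n dvd m" and k: "k \<in> a m"
  shows "k \<in> a n"
proof -
  have "a n = int_mod_proj n (a m)"
    using a assms(2-4) by (simp add: carrier_Zhat divlim_carrierD(3))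
  also have "\<dots> = int_multiples n #>\<^bsub>integer_group\<^esub> k"
    unfolding Zhat_component_eq[OF a assms(3) k] by (rule int_mod_proj_coset[OF assms(4)])
  finally show ?thesis by (simp add: mem_int_coset_iff mem_int_multiples_iff)
qed

lemma int_to_Zhat_in_carrier: "int_to_Zhat k \<in> carrier Zhat"
  by (auto simp: int_to_Zhat_def carrier_Zhat divlim_carrier_def int_mod_proj_coset
      int_mod_group_def carrier_FactGroup)

section \<open>The homomorphism onto the limit of the circles\<close>

text \<open>An arbitrary integer of the coset \<open>a n\<close> stands for this component;
  \<open>solenoid_map_eq\<close> removes the choice. The restriction to positive labels matches the
  extensional points of the limit.\<close>

definition solenoid_map :: "(nat \<Rightarrow> int set) \<times> real \<Rightarrow> nat \<Rightarrow> real set" where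
  "solenoid_map = (\<lambda>(a, x). \<lambda>n\<in>{0<..}.
     real_multiples n #>\<^bsub>real_group\<^esub> (x - of_int (SOME k. k \<in> a n)))"

text \<open>Two integers in \<open>a n\<close> differ by a multiple of \<open>n\<close>, which
  disappears in R/nZ, so any of them may replace the chosen one.\<close>

lemma solenoid_map_eq:
  assumes a: "a \<in> carrier Zhat" and n: "0 < n" and k: "k \<in> a n"
  shows "solenoid_map (a, x) n = real_multiples n #>\<^bsub>real_group\<^esub> (x - of_int k)"
proof -
  let ?j = "SOME k. k \<in> a n"
  have "?j \<in> a n" using k by (rule someI)
  then have "?j - k \<in> int_multiples n"
    unfolding Zhat_component_eq[OF a n k] mem_int_coset_iff .
  then have "real_of_int (?j - k) \<in> real_multiples n"
    by (simp only: of_int_mem_real_multiples_iff)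
  then have "real_multiples n #>\<^bsub>real_group\<^esub> (x - of_int ?j) = real_multiples n #>\<^bsub>real_group\<^esub> (x - of_int k)"
    unfolding real_coset_eq_iff by simp
  then show ?thesis using n by (simp add: solenoid_map_def)
qed

text \<open>An integer taken from \<open>a m\<close> also represents \<open>a n\<close>, so the
  transition map merely changes the modulus of one and the same real number.\<close>

lemma solenoid_map_in_carrier:
  assumes a: "a \<in> carrier Zhat"
  shows "solenoid_map (a, x) \<in> carrier circle_limit"
proof -
  have "circle_proj n (solenoid_map (a, x) m) = solenoid_map (a, x) n"
    if nm: "0 < n" "0 < m" "n dvd m" for n m
  proof -
    obtain k where k: "k \<in> a m" using a nm(2) by (rule Zhat_componentE)
    then have "k \<in> a n" using Zhat_component_compat[OF a nm] by blast
    then show ?thesis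
      using a nm k by (simp add: solenoid_map_eq circle_proj_coset)
  qed
  then show ?thesis
    unfolding carrier_circle_limit divlim_carrier_def by (auto simp: solenoid_map_def)
qed

lemma Zhat_real_group: "group (Zhat \<times>\<times> real_group)"
  by (intro DirProd_group topological_groupD(1)[OF topological_group_Zhat] group_real_group)

text \<open>If \<open>k\<close> represents \<open>a n\<close> and \<open>l\<close> represents
  \<open>b n\<close>, then \<open>k + l\<close> represents the component of the product, and the
  difference of sums splits accordingly.\<close>

lemma solenoid_map_hom: "solenoid_map \<in> hom (Zhat \<times>\<times> real_group) circle_limit"
proof (rule homI)
  fix p assume "p \<in> carrier (Zhat \<times>\<times> real_group)"
  then obtain a x where p: "p = (a, x)" "a \<in> carrier Zhat" by auto
  then show "solenoid_map p \<in> carrier circle_limit" by (simp add: solenoid_map_in_carrier)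
  fix q assume "q \<in> carrier (Zhat \<times>\<times> real_group)"
  then obtain b y where q: "q = (b, y)" "b \<in> carrier Zhat" by auto
  let ?c = "a \<otimes>\<^bsub>Zhat\<^esub> b"
  have c: "?c \<in> carrier Zhat"
    using p q topological_groupD(1)[OF topological_group_Zhat]
    by (simp add: group.is_monoid monoid.m_closed)
  have *: "solenoid_map (?c, x + y) n = solenoid_map p n \<otimes>\<^bsub>circle_group n\<^esub> solenoid_map q n"
    if n: "0 < n" for n
  proof -
    obtain k where k: "a n = int_multiples n #>\<^bsub>integer_group\<^esub> k" "k \<in> a n"
      using p(2) n by (rule Zhat_componentE)
    obtain l where l: "b n = int_multiples n #>\<^bsub>integer_group\<^esub> l" "l \<in> b n"
      using q(2) n by (rule Zhat_componentE)
    have "?c n = int_multiples n #>\<^bsub>integer_group\<^esub> (k + l)"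
      using n normal.rcos_sum[OF int_multiples_normal, of k l n]
      by (simp add: Zhat_def int_mod_group_def k(1) l(1))
    then have "k + l \<in> ?c n" by (simp add: mem_int_coset_iff mem_int_multiples_iff)
    then have "solenoid_map (?c, x + y) n
        = real_multiples n #>\<^bsub>real_group\<^esub> ((x - of_int k) + (y - of_int l))"
      using solenoid_map_eq[OF c n] by (simp add: algebra_simps)
    also have "\<dots> = solenoid_map p n \<otimes>\<^bsub>circle_group n\<^esub> solenoid_map q n"
      using normal.rcos_sum[OF real_multiples_normal, of "x - of_int k" "y - of_int l" n]
        solenoid_map_eq[OF p(2) n k(2)] solenoid_map_eq[OF q(2) n l(2)]
      by (simp add: p(1) q(1) circle_group_def)
    finally show ?thesis .
  qed
  \<comment> \<open>To compare the two families as functions, the label 0 has to be treated too;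
    there both sides are \<open>undefined\<close>.\<close>
  have "solenoid_map (?c, x + y) = (\<lambda>n\<in>{0<..}. solenoid_map p n \<otimes>\<^bsub>circle_group n\<^esub> solenoid_map q n)"
  proof
    show "solenoid_map (?c, x + y) n
        = (\<lambda>n\<in>{0<..}. solenoid_map p n \<otimes>\<^bsub>circle_group n\<^esub> solenoid_map q n) n" for n
      using *[of n] by (cases "0 < n") (simp_all add: solenoid_map_def)
  qed
  then show "solenoid_map (p \<otimes>\<^bsub>Zhat \<times>\<times> real_group\<^esub> q) = solenoid_map p \<otimes>\<^bsub>circle_limit\<^esub> solenoid_map q"
    by (simp add: p(1) q(1) circle_limit_def)
qed

lemma solenoid_map_surj:
  "solenoid_map ` carrier (Zhat \<times>\<times> real_group) = carrier circle_limit"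
proof
  show "solenoid_map ` carrier (Zhat \<times>\<times> real_group) \<subseteq> carrier circle_limit"
    using solenoid_map_in_carrier by auto
  show "carrier circle_limit \<subseteq> solenoid_map ` carrier (Zhat \<times>\<times> real_group)"
  proof
    fix c assume "c \<in> carrier circle_limit"
    then have c: "c \<in> divlim_carrier circle_group circle_proj" by (simp add: carrier_circle_limit)
    have "\<exists>y. c n = real_multiples n #>\<^bsub>real_group\<^esub> y" if "0 < n" for n
      using divlim_carrierD(2)[OF c that] by (auto simp: circle_group_def carrier_FactGroup)
    then obtain y where y: "\<And>n. 0 < n \<Longrightarrow> c n = real_multiples n #>\<^bsub>real_group\<^esub> y n" by metis
    have yd: "y n - y m \<in> real_multiples n" if "0 < n" "0 < m" "n dvd m" for n m
      using divlim_carrierD(3)[OF c that] y that by (simp add: circle_proj_coset real_coset_eq_iff)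
    \<comment> \<open>The label 1 divides every label, and the multiples of 1 are all the
      integers.\<close>
    have "\<exists>k. y 1 - y n = of_int k" if "0 < n" for n
      using yd[of 1 n] that by (auto simp: real_multiples_def)
    then obtain k where k: "\<And>n. 0 < n \<Longrightarrow> y 1 - y n = of_int (k n)" by metis
    \<comment> \<open>This choice solves \<open>y 1 - k n = y n\<close>, so that
      \<open>(a, y 1)\<close> is mapped to \<open>c\<close>.\<close>
    define a where "a = (\<lambda>n\<in>{0<..}. int_multiples n #>\<^bsub>integer_group\<^esub> k n)"
    have "k n - k m \<in> int_multiples n" if nm: "0 < n" "0 < m" "n dvd m" for n m
    proof -
      have "real_of_int (k m - k n) = y n - y m"
        unfolding of_int_diff using k[OF nm(1)] k[OF nm(2)] by linarith
      then have "real_of_int (k m - k n) \<in> real_multiples n"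
        using yd[OF nm] by (simp only:)
      then show ?thesis
        unfolding of_int_mem_real_multiples_iff mem_int_multiples_iff by (simp add: dvd_diff_commute)
    qed
    then have a: "a \<in> carrier Zhat"
      by (auto simp: a_def carrier_Zhat divlim_carrier_def int_mod_group_def carrier_FactGroup
          int_mod_proj_coset int_coset_eq_iff)
    have "solenoid_map (a, y 1) n = c n" if n: "0 < n" for n
    proof -
      have "k n \<in> a n" using n by (simp add: a_def mem_int_coset_iff mem_int_multiples_iff)
      then have "solenoid_map (a, y 1) n = real_multiples n #>\<^bsub>real_group\<^esub> (y 1 - of_int (k n))"
        by (rule solenoid_map_eq[OF a n])
      also have "y 1 - of_int (k n) = y n" using k[OF n] by simp
      finally show ?thesis using y[OF n] by simp
    qed
    moreover have "solenoid_map (a, y 1) n = c n" if "\<not> 0 < n" for n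
      using that PiE_arb[OF divlim_carrierD(1)[OF c], of n] by (simp add: solenoid_map_def)
    ultimately have "c = solenoid_map (a, y 1)" by (intro ext) metis
    then show "c \<in> solenoid_map ` carrier (Zhat \<times>\<times> real_group)"
      using a by auto
  qed
qed

lemma kernel_solenoid_map:
  "kernel (Zhat \<times>\<times> real_group) circle_limit solenoid_map = diagonal_int"
proof
  have one: "\<one>\<^bsub>circle_limit\<^esub> n = real_multiples n #>\<^bsub>real_group\<^esub> 0" if "0 < n" for n
    using that subgroup.subset[OF real_multiples_subgroup]
      group.coset_mult_one[OF group_real_group, of "real_multiples n"]
    by (simp add: circle_limit_def circle_group_def)
  show "diagonal_int \<subseteq> kernel (Zhat \<times>\<times> real_group) circle_limit solenoid_map"
  proof
    fix p assume "p \<in> diagonal_int"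
    then obtain k where p: "p = (int_to_Zhat k, of_int k)" by (auto simp: diagonal_int_def)
    have "solenoid_map p n = \<one>\<^bsub>circle_limit\<^esub> n" if n: "0 < n" for n
    proof -
      have "k \<in> int_to_Zhat k n"
        using n by (simp add: int_to_Zhat_def mem_int_coset_iff mem_int_multiples_iff)
      then show ?thesis
        using solenoid_map_eq[OF int_to_Zhat_in_carrier n] one[OF n] by (simp add: p)
    qed
    moreover have "solenoid_map p n = \<one>\<^bsub>circle_limit\<^esub> n" if "\<not> 0 < n" for n
      using that by (simp add: p solenoid_map_def circle_limit_def)
    ultimately have "solenoid_map p = \<one>\<^bsub>circle_limit\<^esub>" by (intro ext) metis
    then show "p \<in> kernel (Zhat \<times>\<times> real_group) circle_limit solenoid_map"
      by (simp add: kernel_def p int_to_Zhat_in_carrier)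
  qed
  show "kernel (Zhat \<times>\<times> real_group) circle_limit solenoid_map \<subseteq> diagonal_int"
  proof
    fix p assume "p \<in> kernel (Zhat \<times>\<times> real_group) circle_limit solenoid_map"
    then obtain a x where p: "p = (a, x)" and a: "a \<in> carrier Zhat"
      and eq: "solenoid_map (a, x) = \<one>\<^bsub>circle_limit\<^esub>"
      by (auto simp: kernel_def)
    have d: "x - of_int l \<in> real_multiples n" if "0 < n" "l \<in> a n" for n l
    proof -
      have "real_multiples n #>\<^bsub>real_group\<^esub> 0 = real_multiples n #>\<^bsub>real_group\<^esub> (x - of_int l)"
        unfolding one[OF that(1), symmetric] eq[symmetric] by (rule solenoid_map_eq[OF a that])
      then show ?thesis by (simp only: real_coset_eq_iff diff_zero)
    qed
    obtain l where "l \<in> a 1" using a by (rule Zhat_componentE[of a 1]) simp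
    \<comment> \<open>The label 1 shows that \<open>x\<close> is an integer. The remaining labels
      then force this integer to represent every component of \<open>a\<close>.\<close>
    then obtain j where "x - of_int l = of_int j"
      using d[of 1 l] by (auto simp: real_multiples_def)
    then have x: "x = of_int (l + j)" by simp
    have "a n = int_to_Zhat (l + j) n" if n: "0 < n" for n
    proof -
      obtain k where k: "a n = int_multiples n #>\<^bsub>integer_group\<^esub> k" "k \<in> a n"
        using a n by (rule Zhat_componentE)
      have "real_of_int (l + j - k) \<in> real_multiples n"
        using d[OF n k(2)] x by simp
      then have "l + j - k \<in> int_multiples n" by (simp only: of_int_mem_real_multiples_iff)
      then show ?thesis using n by (simp add: k(1) int_to_Zhat_def int_coset_eq_iff)
    qed
    moreover have "a n = int_to_Zhat (l + j) n" if "\<not> 0 < n" for n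
      using that PiE_arb[OF divlim_carrierD(1)[OF a[unfolded carrier_Zhat]], of n]
      by (simp add: int_to_Zhat_def)
    ultimately have "a = int_to_Zhat (l + j)" by (intro ext) metis
    then show "p \<in> diagonal_int" by (auto simp: p x diagonal_int_def)
  qed
qed

text \<open>Choosing representatives is continuous because the groups \<open>\<int>/n\<int>\<close> are discrete.\<close>

lemma continuous_map_solenoid_map:
  "continuous_map (prod_topology Zhat_topology euclideanreal) circle_limit_topology solenoid_map"
  unfolding circle_limit_topology_def
proof (rule continuous_map_into_divlim)
  let ?P = "prod_topology Zhat_topology euclideanreal"
  fix n :: nat assume n: "0 < n"
  have "continuous_map ?P (int_mod_topology n) (\<lambda>p. fst p n)"
    using continuous_map_compose[OF continuous_map_fst continuous_map_divlim_component[OF n], unfolded o_def]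
    unfolding Zhat_topology_def .
  then have "continuous_map ?P euclideanreal ((\<lambda>c. of_int (SOME k. k \<in> c)) \<circ> (\<lambda>p. fst p n))"
    by (rule continuous_map_compose) (simp add: int_mod_topology_def)
  then have "continuous_map ?P (circle_topology n)
      (\<lambda>p. real_multiples n #>\<^bsub>real_group\<^esub> (snd p - of_int (SOME k. k \<in> fst p n)))"
    unfolding circle_topology_def
    by (intro continuous_map_coset continuous_map_diff continuous_map_snd) (simp add: o_def)
  then show "continuous_map ?P (circle_topology n) (\<lambda>p. solenoid_map p n)"
    using n by (simp add: solenoid_map_def case_prod_unfold)
next
  show "solenoid_map \<in> topspace (prod_topology Zhat_topology euclideanreal)
      \<rightarrow> divlim_carrier circle_group circle_proj"
    using solenoid_map_in_carrier topological_groupD(2)[OF topological_group_Zhat]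
    by (auto simp: carrier_circle_limit)
qed

section \<open>The quotient group S\<close>

text \<open>Comes for free from the description of the diagonal as a kernel.\<close>

lemma diagonal_int_normal: "diagonal_int \<lhd> Zhat \<times>\<times> real_group"
  using group_hom.normal_kernel[of "Zhat \<times>\<times> real_group" circle_limit solenoid_map]
  by (simp add: group_hom_def group_hom_axioms_def kernel_solenoid_map solenoid_map_hom
      Zhat_real_group group_circle_limit)

lemma topological_group_S: "topological_group S_group S_topology"
  unfolding S_group_def S_topology_def
  by (intro topological_group_Mod topological_group_DirProd topological_group_Zhat
      topological_group_real_group diagonal_int_normal)

lemma compact_space_S: "compact_space S_topology"
proof -
  let ?G = "Zhat \<times>\<times> real_group" and ?P = "prod_topology Zhat_topology euclideanreal"
  let ?q = "\<lambda>p. diagonal_int #>\<^bsub>?G\<^esub> p"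
  have ts: "topspace Zhat_topology = carrier Zhat"
    using topological_groupD(2)[OF topological_group_Zhat] .
  have "compactin ?P (carrier Zhat \<times> {0..1})"
    using compact_space_Zhat ts by (simp add: compactin_Times compact_space_def)
  then have "compactin S_topology (?q ` (carrier Zhat \<times> {0..1}))"
    unfolding S_topology_def
    by (rule image_compactin[OF _ quotient_imp_continuous_map[OF quotient_map_coset_topology]])
  moreover have "?q ` (carrier Zhat \<times> {0..1}) = topspace S_topology"
  proof
    show "?q ` (carrier Zhat \<times> {0..1}) \<subseteq> topspace S_topology"
      by (auto simp: S_topology_def ts)
    show "topspace S_topology \<subseteq> ?q ` (carrier Zhat \<times> {0..1})"
    proof
      fix C assume "C \<in> topspace S_topology"
      then obtain a x where ax: "a \<in> carrier Zhat" "C = ?q (a, x)" by (auto simp: S_topology_def ts)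
      interpret G: group ?G by (rule Zhat_real_group)
      \<comment> \<open>Translation by this diagonal element changes the real coordinate into the
        fractional part of \<open>x\<close> and stays in the same class.\<close>
      define d where "d = (int_to_Zhat (- \<lfloor>x\<rfloor>), real_of_int (- \<lfloor>x\<rfloor>))"
      have d: "d \<in> diagonal_int" "d \<in> carrier ?G"
        by (auto simp: d_def diagonal_int_def int_to_Zhat_in_carrier)
      let ?p = "d \<otimes>\<^bsub>?G\<^esub> (a, x)"
      have axG: "(a, x) \<in> carrier ?G" using ax by simp
      have p: "?p \<in> carrier ?G" using d(2) axG by (rule G.m_closed)
      have "?p \<otimes>\<^bsub>?G\<^esub> inv\<^bsub>?G\<^esub> (a, x) = d"
        by (simp only: G.m_assoc[OF d(2) axG G.inv_closed[OF axG]] G.r_inv[OF axG] G.r_one[OF d(2)])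
      then have "?q ?p = C"
        using G.rcos_eq_iff[OF normal_imp_subgroup[OF diagonal_int_normal] axG p] d(1) ax(2) by simp
      have "snd ?p \<in> {0..1}" unfolding d_def by (simp add: mult_DirProd') linarith
      then have "?p \<in> carrier Zhat \<times> {0..1}" using p by (cases ?p) auto
      with \<open>?q ?p = C\<close> show "C \<in> ?q ` (carrier Zhat \<times> {0..1})" by (rule image_eqI[OF sym])
    qed
  qed
  ultimately show ?thesis by (simp add: compact_space_def)
qed

section \<open>The induced isomorphism\<close>

text \<open>On a coset of the kernel the homomorphism takes a single value, which
  \<open>the_elem\<close> extracts. This is the form of the induced map in the first isomorphism
  theorem \<open>FactGroup_iso_set\<close>.\<close>

definition solenoid_iso :: "((nat \<Rightarrow> int set) \<times> real) set \<Rightarrow> nat \<Rightarrow> real set" where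
  "solenoid_iso C = the_elem (solenoid_map ` C)"

lemma solenoid_iso_coset:
  assumes "p \<in> carrier (Zhat \<times>\<times> real_group)"
  shows "solenoid_iso (diagonal_int #>\<^bsub>Zhat \<times>\<times> real_group\<^esub> p) = solenoid_map p"
proof -
  let ?G = "Zhat \<times>\<times> real_group"
  interpret h: group_hom ?G circle_limit solenoid_map
    by (simp add: group_hom_def group_hom_axioms_def solenoid_map_hom Zhat_real_group group_circle_limit)
  have "solenoid_map (d \<otimes>\<^bsub>?G\<^esub> p) = solenoid_map p" if "d \<in> diagonal_int" for d
  proof -
    have "d \<in> carrier ?G" "solenoid_map d = \<one>\<^bsub>circle_limit\<^esub>"
      using that unfolding kernel_solenoid_map[symmetric] kernel_def by auto
    then show ?thesis using assms h.hom_mult[of d p] h.hom_closed[OF assms] by (simp del: mult_DirProd)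
  qed
  \<comment> \<open>Constancy alone would allow an empty image; nonemptiness makes it a
    singleton.\<close>
  moreover have "diagonal_int \<noteq> {}" by (simp add: diagonal_int_def)
  ultimately have "solenoid_map ` (diagonal_int #>\<^bsub>?G\<^esub> p) = {solenoid_map p}"
    by (simp add: r_coset_def image_UN cong: SUP_cong_simp)
  then show ?thesis by (simp add: solenoid_iso_def)
qed

lemma solenoid_iso_topological_iso:
  "solenoid_iso \<in> topological_iso S_group S_topology circle_limit circle_limit_topology"
proof -
  let ?G = "Zhat \<times>\<times> real_group" and ?P = "prod_topology Zhat_topology euclideanreal"
  interpret h: group_hom ?G circle_limit solenoid_map
    by (simp add: group_hom_def group_hom_axioms_def solenoid_map_hom Zhat_real_group group_circle_limit)
  have iso: "solenoid_iso \<in> iso S_group circle_limit"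
    using h.FactGroup_iso_set[OF solenoid_map_surj]
    unfolding kernel_solenoid_map S_group_def solenoid_iso_def[abs_def] .
  have ts: "topspace ?P = carrier ?G"
    using topological_groupD(2)[OF topological_group_Zhat] by simp
  have "continuous_map S_topology circle_limit_topology solenoid_iso"
    unfolding S_topology_def
  \<comment> \<open>Composed with the projection to the cosets, the induced map is
    \<open>solenoid_map\<close>, whose continuity therefore descends to S.\<close>
  proof (rule continuous_compose_quotient_map[OF quotient_map_coset_topology])
    show "continuous_map ?P circle_limit_topology (solenoid_iso \<circ> (\<lambda>p. diagonal_int #>\<^bsub>?G\<^esub> p))"
      using continuous_map_solenoid_map
      by (rule continuous_map_eq) (simp add: ts solenoid_iso_coset del: topspace_prod_topology carrier_DirProd)
  qed
  moreover have "bij_betw solenoid_iso (topspace S_topology) (topspace circle_limit_topology)"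
    using iso topological_groupD(2)[OF topological_group_S] by (simp add: iso_def topspace_circle_limit)
  ultimately have "homeomorphic_map S_topology circle_limit_topology solenoid_iso"
    by (intro continuous_imp_homeomorphic_map compact_space_S Hausdorff_space_circle_limit)
      (auto simp: bij_betw_def)
  then show ?thesis using iso by (simp add: topological_iso_def)
qed

lemma canonical_on_S_solenoid_iso: "canonical_on_S solenoid_iso"
  unfolding canonical_on_S_def S_class_def
proof (intro ballI allI impI)
  fix a x k and n :: nat assume a: "a \<in> carrier Zhat" and n: "0 < n" and k: "k \<in> a n"
  have "(a, x) \<in> carrier (Zhat \<times>\<times> real_group)" using a by simp
  then have "solenoid_iso (diagonal_int #>\<^bsub>Zhat \<times>\<times> real_group\<^esub> (a, x)) = solenoid_map (a, x)"
    by (rule solenoid_iso_coset)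
  then show "solenoid_iso (diagonal_int #>\<^bsub>Zhat \<times>\<times> real_group\<^esub> (a, x)) n
      = real_multiples n #>\<^bsub>real_group\<^esub> (x - of_int k)"
    by (simp only: solenoid_map_eq[OF a n k])
qed

theorem proposition9p2:
  shows "compact_group S_group S_topology \<and>
         connected_space S_topology \<and>
         (\<forall>n>0. compact_group (circle_group n) (circle_topology n)) \<and>
         (\<exists>\<phi> \<in> topological_iso S_group S_topology circle_limit circle_limit_topology.
            canonical_on_S \<phi>)"
proof (intro conjI allI impI)
  \<comment> \<open>The Hausdorff property and connectedness of S are pulled back from the limit
    along this homeomorphism; compactness was shown directly on S.\<close>
  have "S_topology homeomorphic_space circle_limit_topology"
    using solenoid_iso_topological_iso homeomorphic_map_imp_homeomorphic_space
    by (auto simp: topological_iso_def)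
  then show "compact_group S_group S_topology" "connected_space S_topology"
    using topological_group_S compact_space_S Hausdorff_space_circle_limit connected_space_circle_limit
    by (simp_all add: compact_group_def homeomorphic_Hausdorff_space homeomorphic_connected_space)
  show "compact_group (circle_group n) (circle_topology n)" if "0 < n" for n
    using that by (rule compact_group_circle)
  show "\<exists>\<phi> \<in> topological_iso S_group S_topology circle_limit circle_limit_topology. canonical_on_S \<phi>"
    using solenoid_iso_topological_iso canonical_on_S_solenoid_iso by blast
qed

end
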